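(* Let $1\ge\alpha>\beta>\gamma>0$, $\lambda_1,\lambda_2,\lambda_3\in\mathbb{R}$ and $y_0\in\mathbb{R}$. Then the function $$y(r)=\left(1+\lambda_{1}r^{\alpha}E_{\alpha,\alpha-\gamma,\alpha-\beta,\alpha+1}(\lambda_{1}r^{\alpha},\lambda_{2}r^{\alpha-\gamma},\lambda_{3}r^{\alpha-\beta})\right)y_0$$ is a solution of the initial value problem $$\left({}^{C}D^{\alpha}_{0^+}y\right)(r)-\lambda_{3}\left({}^{C}D^{\beta}_{0^+}y\right)(r)-\lambda_{2}\left({}^{C}D^{\gamma}_{0^+}y\right)(r)-\lambda_{1}y(r)=0,\quad r>0,\qquad y(0)=y_0.$$
   Context: For real $a_1,a_2,a_3>0$ and $\delta\in\mathbb{R}$, the trivariate Mittag-Leffler function (with upper parameter $\eta=1$ omitted from the notation) is $$E_{a_1,a_2,a_3,\delta}(u,v,w)=\sum_{l=0}^{\infty}\sum_{p=0}^{\infty}\sum_{k=0}^{\infty}\frac{(l+p+k)!}{l!\,p!\,k!}\frac{u^l v^p w^k}{\Gamma(la_1+pa_2+ka_3+\delta)},$$ where $1/\Gamma$ is zero at the poles of $\Gamma$. For $0<\rho<1$ the Caputo fractional derivative is $({}^{C}D^{\rho}_{0^+}y)(r)=\frac{1}{\Gamma(1-\rho)}\int_0^r (r-s)^{-\rho}y'(s)\,ds$, $r>0$; for $\rho=1$ it is the ordinary derivative $y'(r)$. *)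

theory Defs
  imports "HOL-Analysis.Analysis"
begin

text \<open>\<open>rGamma\<close> is \<open>1/\<Gamma>\<close>, which vanishes at the poles of \<open>\<Gamma>\<close>.\<close>

definition mittag_leffler3 ::
  "real \<Rightarrow> real \<Rightarrow> real \<Rightarrow> real \<Rightarrow> real \<Rightarrow> real \<Rightarrow> real \<Rightarrow> real" where
  "mittag_leffler3 a1 a2 a3 \<delta> u v w =
     (\<Sum>l. \<Sum>p. \<Sum>k. fact (l + p + k) / (fact l * fact p * fact k) * (u ^ l * v ^ p * w ^ k)
        * rGamma (real l * a1 + real p * a2 + real k * a3 + \<delta>))"

text \<open>Both definitions below are meaningful only for \<open>0 < \<rho> \<le> 1\<close> and \<open>r > 0\<close>.
  Since \<open>deriv\<close> and the Lebesgue integral are total, the value \<open>caputo_deriv \<rho> y r\<close> is the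
  Caputo derivative only if \<open>caputo_differentiable \<rho> y r\<close> holds.\<close>

definition caputo_differentiable :: "real \<Rightarrow> (real \<Rightarrow> real) \<Rightarrow> real \<Rightarrow> bool" where
  "caputo_differentiable \<rho> y r \<longleftrightarrow>
     (if \<rho> = 1 then y differentiable (at r)
      else (\<forall>s\<in>{0<..<r}. y differentiable (at s)) \<and>
           set_integrable lborel {0<..<r} (\<lambda>s. (r - s) powr (- \<rho>) * deriv y s))"

definition caputo_deriv :: "real \<Rightarrow> (real \<Rightarrow> real) \<Rightarrow> real \<Rightarrow> real" where
  "caputo_deriv \<rho> y r =
     (if \<rho> = 1 then deriv y r
      else 1 / Gamma (1 - \<rho>) * (LBINT s:{0<..<r}. (r - s) powr (- \<rho>) * deriv y s))"

text \<open>Continuity on \<open>[0,\<infinity>)\<close> is what ties the initial value to the equation on \<open>r > 0\<close>.\<close>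

definition is_ivp_solution ::
  "real \<Rightarrow> real \<Rightarrow> real \<Rightarrow> real \<Rightarrow> real \<Rightarrow> real \<Rightarrow> real \<Rightarrow> (real \<Rightarrow> real) \<Rightarrow> bool" where
  "is_ivp_solution \<alpha> \<beta> \<gamma> lam1 lam2 lam3 y0 y \<longleftrightarrow>
     continuous_on {0..} y \<and>
     (\<forall>r>0. caputo_differentiable \<alpha> y r \<and> caputo_differentiable \<beta> y r \<and>
            caputo_differentiable \<gamma> y r \<and>
            caputo_deriv \<alpha> y r - lam3 * caputo_deriv \<beta> y r - lam2 * caputo_deriv \<gamma> y r - lam1 * y r = 0) \<and>
     y 0 = y0"

end

theory Submission
  imports Defs
begin

text \<open>Put \<open>\<phi>\<^sub>\<delta>(r) = \<Sum> (l+p+k)!/(l! p! k!) \<lambda>\<^sub>1\<^sup>l \<lambda>\<^sub>2\<^sup>p \<lambda>\<^sub>3\<^sup>k r\<^bsup>e+\<delta>-1\<^esup> / \<Gamma>(e+\<delta>)\<close>, where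
  \<open>e = l\<alpha> + p(\<alpha>-\<gamma>) + k(\<alpha>-\<beta>)\<close>. Then \<open>y = (1 + \<lambda>\<^sub>1 \<phi>\<^bsub>\<alpha>+1\<^esub>) y\<^sub>0\<close>. Termwise differentiation lowers the
  index \<open>\<delta>\<close> by one, and by the Beta integral the Riemann--Liouville integral of order \<open>\<sigma>\<close> raises it
  by \<open>\<sigma>\<close>, so the Caputo derivative of order \<open>\<rho>\<close> of \<open>y\<close> is \<open>\<lambda>\<^sub>1 \<phi>\<^bsub>\<alpha>+1-\<rho>\<^esub> y\<^sub>0\<close>. The equation becomes
  \<open>\<phi>\<^sub>1 = 1 + \<lambda>\<^sub>1 \<phi>\<^bsub>\<alpha>+1\<^esub> + \<lambda>\<^sub>2 \<phi>\<^bsub>\<alpha>-\<gamma>+1\<^esub> + \<lambda>\<^sub>3 \<phi>\<^bsub>\<alpha>-\<beta>+1\<^esub>\<close>, which is the Pascal recurrence of the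
  trinomial coefficients. All series converge because \<open>1/\<Gamma>(s)\<close> decays faster than any exponential
  \<open>q\<^sup>s\<close>.\<close>

section \<open>Superexponential decay of the reciprocal Gamma function\<close>

text \<open>Cutting the Euler integral down to \<open>{T..}\<close> and replacing
  \<open>t powr s\<close> there by its minimum \<open>T powr s\<close> leaves only a tail of the
  exponential.\<close>

lemma Gamma_ge_powr_exp:
  fixes s T :: real
  assumes "s \<ge> 0" "T > 0"
  shows "T powr s * exp (- T) \<le> Gamma (s + 1)"
proof -
  have *: "((\<lambda>t. T powr s * exp (- t)) has_integral T powr s * exp (- T)) {T..}"
    using has_integral_mult_right[OF has_integral_exp_minus_to_infinity[of 1 T], of "T powr s"] by simp
  have **: "((\<lambda>t. if t \<in> {T..} then T powr s * exp (- t) else 0) has_integral T powr s * exp (- T)) {0..}"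
    by (subst has_integral_restrict) (use assms * in auto)
  have "((\<lambda>t. t powr s / exp t) has_integral Gamma (s + 1)) {0..}"
    using Gamma_integral_real[of "s + 1"] assms by simp
  moreover have "(if t \<in> {T..} then T powr s * exp (- t) else 0) \<le> t powr s / exp t" for t
    using assms by (auto simp: exp_minus divide_inverse intro!: powr_mono2 mult_right_mono)
  ultimately show ?thesis
    by (rule has_integral_le[OF **])
qed

lemma rGamma_nonneg_real:
  fixes s :: real
  assumes "s > 0"
  shows "rGamma s \<ge> 0"
  using assms by (simp add: rGamma_inverse_Gamma less_imp_le[OF Gamma_real_pos])

text \<open>Here \<open>q\<close> may be as small as desired, which is what makes the series
  converge for every argument.\<close>

lemma rGamma_le_powr:
  fixes q :: real
  assumes "q > 0"
  obtains C where "C > 0" "\<And>s. s > 0 \<Longrightarrow> rGamma s \<le> C * q powr s"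
proof
  \<comment> \<open>The factor \<open>exp 1\<close> in \<open>T\<close> yields an
    \<open>exp s\<close> in \<open>T powr s\<close>, which cancels the bound \<open>exp s\<close>
    for the factor \<open>s\<close> in \<open>Gamma (s + 1) = s * Gamma s\<close>.\<close>
  define T where "T = exp 1 / q"
  have T: "T > 0" using assms by (simp add: T_def)
  show "exp T > 0" by simp
  fix s :: real assume s: "s > 0"
  have "T powr s * exp (- T) \<le> s * Gamma s"
    using Gamma_ge_powr_exp[of s T] s T Gamma_plus1[of s] by (auto simp: nonpos_Ints_def)
  moreover have "s \<le> exp s" using exp_ge_add_one_self[of s] by linarith
  moreover have G: "Gamma s > 0" using s by simp
  ultimately have "T powr s * exp (- T) \<le> exp s * Gamma s"
    by (meson less_imp_le mult_right_mono order_trans)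
  moreover have "T powr s = exp s / q powr s"
    using assms by (simp add: T_def powr_divide exp_powr_real)
  then have "T powr s = exp s * inverse (q powr s)"
    by (simp add: divide_inverse)
  ultimately have "inverse (q powr s) * exp (- T) \<le> Gamma s" by simp
  moreover have "0 < inverse (q powr s) * exp (- T)" using assms by simp
  ultimately have "inverse (Gamma s) \<le> inverse (inverse (q powr s) * exp (- T))"
    by (rule le_imp_inverse_le)
  then show "rGamma s \<le> exp T * q powr s"
    by (simp add: rGamma_inverse_Gamma exp_minus mult.commute)
qed

section \<open>Unordered sums over index triples\<close>

lemma summable_on_product_nonneg_real:
  fixes f :: "'a \<Rightarrow> real" and g :: "'b \<Rightarrow> real"
  assumes "f summable_on UNIV" "g summable_on UNIV" "\<And>x. f x \<ge> 0" "\<And>y. g y \<ge> 0"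
  shows "(\<lambda>(x, y). f x * g y) summable_on UNIV"
proof -
  have "(\<lambda>(x, y). f x * g y) summable_on (UNIV \<times> UNIV)"
  proof (rule summable_on_SigmaI)
    show "((\<lambda>y. case (x, y) of (x, y) \<Rightarrow> f x * g y) has_sum f x * infsum g UNIV) UNIV" for x
      using has_sum_cmult_right[OF has_sum_infsum[OF assms(2)]] by simp
    show "(\<lambda>x. f x * infsum g UNIV) summable_on UNIV"
      using assms(1) by (rule summable_on_cmult_left)
  qed (use assms in auto)
  then show ?thesis by simp
qed

lemma summable_on_geometric_half: "(\<lambda>n. (1/2::real) ^ n) summable_on UNIV"
  by (rule norm_summable_imp_summable_on) (auto intro!: summable_geometric)

text \<open>Links the nested \<open>suminf\<close> of \<open>mittag_leffler3\<close> with a single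
  unordered sum, which can be reindexed freely. Summability over all triples allows Fubini for sums
  to be applied twice.\<close>

lemma infsum_triple_eq_suminf:
  fixes f :: "nat \<Rightarrow> nat \<Rightarrow> nat \<Rightarrow> real"
  assumes "(\<lambda>(l, p, k). f l p k) summable_on UNIV"
  shows "(\<Sum>l. \<Sum>p. \<Sum>k. f l p k) = (\<Sum>\<^sub>\<infinity>(l, p, k). f l p k)"
proof -
  have suminf: "suminf g = infsum g UNIV" if "g summable_on UNIV" for g :: "nat \<Rightarrow> real"
    using has_sum_imp_sums[OF has_sum_infsum[OF that]] by (simp add: sums_iff)
  let ?F = "\<lambda>l (p, k). f l p k"
  have S1: "(\<lambda>(l, pk). ?F l pk) summable_on (UNIV \<times> UNIV)"
    using assms by (simp add: case_prod_unfold)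
  have S2: "?F l summable_on (UNIV \<times> UNIV)" for l
    using summable_on_SigmaD1[OF S1, of l] by simp
  have S3: "f l p summable_on UNIV" for l p
    using summable_on_SigmaD1[OF S2, of p] by simp
  have S4: "(\<lambda>p. infsum (f l p) UNIV) summable_on UNIV" for l
    using summable_on_Sigma_banach[OF S2, of l] by simp
  have S5: "(\<lambda>l. infsum (?F l) UNIV) summable_on UNIV"
    using summable_on_Sigma_banach[OF S1] by simp
  have "(\<Sum>l. \<Sum>p. \<Sum>k. f l p k) = (\<Sum>l. infsum (?F l) UNIV)"
    using infsum_Sigma'_banach[OF S2] S3 S4 by (simp add: suminf)
  also have "\<dots> = infsum (\<lambda>(l, pk). ?F l pk) (UNIV \<times> UNIV)"
    using infsum_Sigma'_banach[OF S1] S5 by (simp add: suminf)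
  finally show ?thesis by (simp add: case_prod_unfold)
qed

section \<open>Trinomial coefficients\<close>

definition trinom :: "nat \<Rightarrow> nat \<Rightarrow> nat \<Rightarrow> real" where
  "trinom l p k = fact (l + p + k) / (fact l * fact p * fact k)"

lemma trinom_nonneg: "trinom l p k \<ge> 0"
  by (simp add: trinom_def)

text \<open>A trinomial coefficient is a product of two binomial coefficients, each at most
  \<open>2 ^ (l + p + k)\<close>. The bound is split by index to fit a product of geometric
  series.\<close>

lemma trinom_le: "trinom l p k \<le> 4 ^ l * (4 ^ p * 4 ^ k)"
proof -
  have "trinom l p k = real ((l + p + k) choose l) * real ((p + k) choose p)"
    by (simp add: trinom_def binomial_fact field_simps)
  also have "\<dots> \<le> 2 ^ (l + p + k) * 2 ^ (l + p + k)"
  proof (intro mult_mono)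
    show "real ((l + p + k) choose l) \<le> 2 ^ (l + p + k)"
      using binomial_le_pow2[of "l + p + k" l] by (metis of_nat_le_iff of_nat_numeral of_nat_power)
    have "real ((p + k) choose p) \<le> 2 ^ (p + k)"
      using binomial_le_pow2[of "p + k" p] by (metis of_nat_le_iff of_nat_numeral of_nat_power)
    also have "\<dots> \<le> 2 ^ (l + p + k)" by (intro power_increasing) auto
    finally show "real ((p + k) choose p) \<le> 2 ^ (l + p + k)" .
  qed auto
  also have "\<dots> = (2 * 2) ^ (l + p + k)"
    by (rule power_mult_distrib[symmetric])
  finally show ?thesis by (simp add: power_add)
qed

text \<open>Over the common denominator \<open>D\<close> the three neighbours are \<open>l\<close>,
  \<open>p\<close> and \<open>k\<close> times \<open>fact n\<close>, where
  \<open>l + p + k = Suc n\<close>. The conditionals remove missing neighbours, since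
  \<open>0 - 1 = 0\<close> on naturals.\<close>

lemma trinom_recurrence:
  assumes "l + p + k > 0"
  shows "trinom l p k = (if l = 0 then 0 else trinom (l - 1) p k) +
    (if p = 0 then 0 else trinom l (p - 1) k) + (if k = 0 then 0 else trinom l p (k - 1))"
proof -
  obtain n where n: "l + p + k = Suc n" using assms gr0_conv_Suc by blast
  define D :: real where "D = fact l * fact p * fact k"
  have D: "D \<noteq> 0" by (simp add: D_def)
  have "(if l = 0 then 0 else trinom (l - 1) p k) = real l * fact n / D"
  proof (cases l)
    case (Suc m)
    then have "m + p + k = n" using n by simp
    then show ?thesis by (simp add: Suc trinom_def D_def field_simps del: of_nat_Suc)
  qed simp
  moreover have "(if p = 0 then 0 else trinom l (p - 1) k) = real p * fact n / D"
  proof (cases p)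
    case (Suc m)
    then have "l + m + k = n" using n by simp
    then show ?thesis by (simp add: Suc trinom_def D_def field_simps del: of_nat_Suc)
  qed simp
  moreover have "(if k = 0 then 0 else trinom l p (k - 1)) = real k * fact n / D"
  proof (cases k)
    case (Suc m)
    then have "l + p + m = n" using n by simp
    then show ?thesis by (simp add: Suc trinom_def D_def field_simps del: of_nat_Suc)
  qed simp
  moreover have "trinom l p k = (real l + real p + real k) * fact n / D"
  proof -
    have "trinom l p k = real (Suc n) * fact n / D"
      by (simp only: trinom_def D_def n fact_Suc of_nat_mult of_nat_fact)
    also have "real (Suc n) = real l + real p + real k"
      by (simp only: n[symmetric] of_nat_add)
    finally show ?thesis .
  qed
  ultimately show ?thesis by (simp add: add_divide_distrib distrib_right)
qed

section \<open>The Beta integral over an interval of length \<open>r\<close>\<close>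

lemma powr_diff_one:
  fixes r :: real
  assumes "r > 0"
  shows "r powr (s - 1) = r powr s / r"
  using assms by (simp add: powr_diff)

text \<open>Substituting \<open>s = r * t\<close> gives the Beta integral on the unit interval. The
  two powers contribute the exponent \<open>a + b - 2\<close> of \<open>r\<close>, the Jacobian one
  more.\<close>

lemma has_bochner_integral_powr_convolution:
  fixes a b r :: real
  assumes "a > 0" "b > 0" "r > 0"
  shows "has_bochner_integral lborel
    (\<lambda>s. indicator {0<..<r} s * ((r - s) powr (a - 1) * s powr (b - 1))) (Beta a b * r powr (a + b - 1))"
proof -
  let ?f = "\<lambda>s. indicator {0<..<r} s * ((r - s) powr (a - 1) * s powr (b - 1))"
  let ?g = "\<lambda>t. indicator {0..1} t *\<^sub>R (t powr (b - 1) * (1 - t) powr (a - 1))"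
  have g: "integrable lborel ?g"
    using integrable_Beta[OF assms(2,1)] unfolding set_integrable_def .
  have g_int: "(\<integral>t. ?g t \<partial>lborel) = Beta a b"
    using set_borel_integral_eq_integral(2)[OF integrable_Beta[OF assms(2,1)]]
      integral_unique[OF has_integral_Beta_real[OF assms(2,1)]]
    by (simp add: set_lebesgue_integral_def Beta_commute)
  have fg: "?f (0 + r * t) = r powr (a + b - 2) * ?g t" for t
  proof (cases "0 < t \<and> t < 1")
    case True
    have "(r - r * t) powr (a - 1) = r powr (a - 1) * (1 - t) powr (a - 1)"
      using True assms by (subst powr_mult[symmetric]) (auto simp: algebra_simps)
    moreover have "(r * t) powr (b - 1) = r powr (b - 1) * t powr (b - 1)"
      using True assms by (subst powr_mult) auto
    moreover have "r powr (a + b - 2) = r powr (a - 1) * r powr (b - 1)"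
      by (simp add: powr_add[symmetric])
    ultimately show ?thesis using True assms by (simp add: indicator_def)
  next
    case False
    then have "t \<le> 0 \<or> t \<ge> 1" by auto
    \<comment> \<open>The closed indicator of \<open>?g\<close> is 1 at the end points, but
      \<open>0 powr _ = 0\<close> makes \<open>?g\<close> vanish there.\<close>
    then show ?thesis using assms by (auto simp: indicator_def zero_less_mult_iff)
  qed
  have "integrable lborel (\<lambda>t. ?f (0 + r * t))"
    unfolding fg by (intro integrable_mult_right g)
  then have "integrable lborel ?f"
    using assms by (subst (asm) lborel_integrable_real_affine_iff) auto
  moreover have "(\<integral>s. ?f s \<partial>lborel) = r * (\<integral>t. r powr (a + b - 2) * ?g t \<partial>lborel)"
    using lborel_integral_real_affine[of r ?f 0] assms unfolding fg by simp
  then have "(\<integral>s. ?f s \<partial>lborel) = Beta a b * (r powr 1 * r powr (a + b - 2))"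
    using assms g_int by simp
  then have "(\<integral>s. ?f s \<partial>lborel) = Beta a b * r powr (a + b - 1)"
    by (simp only: powr_add[symmetric]) simp
  ultimately show ?thesis by (simp add: has_bochner_integral_iff)
qed

section \<open>The series and its convergence\<close>

locale mittag_leffler3_series =
  fixes a1 a2 a3 x1 x2 x3 :: real
  assumes a1_pos: "a1 > 0" and a2_pos: "a2 > 0" and a3_pos: "a3 > 0"
begin

definition coeff :: "nat \<times> nat \<times> nat \<Rightarrow> real" where
  "coeff = (\<lambda>(l, p, k). trinom l p k * (x1 ^ l * x2 ^ p * x3 ^ k))"

definition expo :: "nat \<times> nat \<times> nat \<Rightarrow> real" where
  "expo = (\<lambda>(l, p, k). real l * a1 + real p * a2 + real k * a3)"

text \<open>Since \<open>0 powr _ = 0\<close>, every term vanishes at \<open>r = 0\<close>, even the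
  leading one for \<delta> = 1, which equals 1 for all \<open>r > 0\<close>.\<close>

definition kterm :: "real \<Rightarrow> nat \<times> nat \<times> nat \<Rightarrow> real \<Rightarrow> real" where
  "kterm \<delta> i r = coeff i * rGamma (expo i + \<delta>) * r powr (expo i + \<delta> - 1)"

text \<open>The function \<open>\<phi>\<^sub>\<delta>\<close> of the introduction.\<close>

definition kernel :: "real \<Rightarrow> real \<Rightarrow> real" where
  "kernel \<delta> r = (\<Sum>\<^sub>\<infinity>i. kterm \<delta> i r)"

text \<open>Termwise differentiation and integration are applied to series over \<open>nat\<close>,
  so the triples are enumerated once and for all.\<close>

definition enum :: "nat \<Rightarrow> nat \<times> nat \<times> nat" where
  "enum = from_nat_into UNIV"

lemma bij_enum: "bij enum"
  unfolding enum_def by (rule bij_betw_from_nat_into) (auto simp: finite_prod)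

lemma expo_nonneg: "expo i \<ge> 0"
  using a1_pos a2_pos a3_pos by (simp add: expo_def split: prod.split)

lemma abs_kterm:
  assumes "\<delta> > 0"
  shows "\<bar>kterm \<delta> i r\<bar> = \<bar>coeff i\<bar> * rGamma (expo i + \<delta>) * r powr (expo i + \<delta> - 1)"
proof -
  have "rGamma (expo i + \<delta>) \<ge> 0"
    using expo_nonneg[of i] assms by (intro rGamma_nonneg_real) simp
  then show ?thesis by (simp add: kterm_def abs_mult)
qed

text \<open>With \<open>q\<close> small enough in the decay bound for \<open>rGamma\<close>, the
  terms are dominated by a product of three geometric series of ratio 1/2. The other convergence
  facts for the series rest on this estimate.\<close>

lemma summable_majorant:
  assumes "\<delta> > 0" "R > 0"
  shows "(\<lambda>i. \<bar>coeff i\<bar> * rGamma (expo i + \<delta>) * R powr (expo i + \<delta>)) summable_on UNIV"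
proof -
  \<comment> \<open>The 4 comes from \<open>trinom_le\<close>; each of the three ratios tends to 0
    with \<open>q\<close> because its exponent is positive.\<close>
  have "\<forall>\<^sub>F q in at_right 0. 4 * \<bar>x\<bar> * (q * R) powr a < 1 / 2" if "a > 0" for x a :: real
  proof -
    have "((\<lambda>q. 4 * \<bar>x\<bar> * (q * R) powr a) \<longlongrightarrow> 4 * \<bar>x\<bar> * 0) (at_right 0)"
    proof (intro tendsto_mult tendsto_const tendsto_zero_powrI)
      show "((\<lambda>q. q * R) \<longlongrightarrow> 0) (at_right 0)"
        by (auto intro!: tendsto_eq_intros)
      show "\<forall>\<^sub>F q in at_right 0. 0 \<le> q * R"
        using eventually_at_right_less[of 0] assms by (auto elim: eventually_mono)
    qed (use that in auto)
    then show ?thesis by (rule order_tendstoD) simp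
  qed
  from this[OF a1_pos, of x1] this[OF a2_pos, of x2] this[OF a3_pos, of x3] eventually_at_right_less[of 0]
  have "\<forall>\<^sub>F q in at_right 0. 4 * \<bar>x1\<bar> * (q * R) powr a1 < 1 / 2 \<and> 4 * \<bar>x2\<bar> * (q * R) powr a2 < 1 / 2
      \<and> 4 * \<bar>x3\<bar> * (q * R) powr a3 < 1 / 2 \<and> 0 < q"
    by eventually_elim auto
  then obtain q where q: "4 * \<bar>x1\<bar> * (q * R) powr a1 < 1 / 2" "4 * \<bar>x2\<bar> * (q * R) powr a2 < 1 / 2"
      "4 * \<bar>x3\<bar> * (q * R) powr a3 < 1 / 2" "0 < q"
    using eventually_happens[of _ "at_right (0::real)"] by (auto simp: trivial_limit_at_right_real)
  obtain C where C: "C > 0" "\<And>s. s > 0 \<Longrightarrow> rGamma s \<le> C * q powr s"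
    using rGamma_le_powr[OF q(4)] by blast
  \<comment> \<open>\<open>D\<close> collects the factors that do not depend on the index.\<close>
  define D where "D = C * (q * R) powr \<delta>"
  have "(\<lambda>(l, p, k). (1/2::real) ^ l * (case (p, k) of (p, k) \<Rightarrow> (1/2) ^ p * (1/2) ^ k)) summable_on UNIV"
    using summable_on_product_nonneg_real[OF summable_on_geometric_half
        summable_on_product_nonneg_real[OF summable_on_geometric_half summable_on_geometric_half]]
    by (simp add: case_prod_unfold)
  then have "(\<lambda>i. D * (case i of (l, p, k) \<Rightarrow> (1/2) ^ l * ((1/2) ^ p * (1/2) ^ k))) summable_on UNIV"
    by (intro summable_on_cmult_right) simp
  then show ?thesis
  proof (rule summable_on_comparison_test)
    fix i :: "nat \<times> nat \<times> nat"
    obtain l p k where i: "i = (l, p, k)" by (cases i) auto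
    have pos: "expo i + \<delta> > 0" using expo_nonneg[of i] assms by simp
    show "\<bar>coeff i\<bar> * rGamma (expo i + \<delta>) * R powr (expo i + \<delta>) \<ge> 0"
      using rGamma_nonneg_real[OF pos] by simp
    let ?y = "\<lambda>x a. 4 * \<bar>x\<bar> * (q * R) powr a"
    have half: "?y x a ^ n \<le> (1 / 2) ^ n" if "?y x a < 1 / 2" for x a :: real and n :: nat
      using that by (intro power_mono) auto
    have pow: "(q * R) powr (real n * a) = ((q * R) powr a) ^ n" for n :: nat and a
      using q(4) assms by (simp add: powr_powr[symmetric] powr_realpow[symmetric] mult.commute)
    have "\<bar>coeff i\<bar> * rGamma (expo i + \<delta>) * R powr (expo i + \<delta>)
        \<le> (4 ^ l * (4 ^ p * 4 ^ k) * (\<bar>x1\<bar> ^ l * \<bar>x2\<bar> ^ p * \<bar>x3\<bar> ^ k)) * (C * q powr (expo i + \<delta>))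
          * R powr (expo i + \<delta>)"
      using C(2)[OF pos] rGamma_nonneg_real[OF pos] trinom_le[of l p k] trinom_nonneg[of l p k]
      by (intro mult_mono) (auto simp: i coeff_def abs_mult power_abs intro!: mult_right_mono)
    also have "\<dots> = C * (4 ^ l * (4 ^ p * 4 ^ k) * (\<bar>x1\<bar> ^ l * \<bar>x2\<bar> ^ p * \<bar>x3\<bar> ^ k)) * (q * R) powr (expo i + \<delta>)"
      using q(4) assms by (simp add: powr_mult)
    also have "(q * R) powr (expo i + \<delta>)
        = ((q * R) powr a1) ^ l * ((q * R) powr a2) ^ p * ((q * R) powr a3) ^ k * (q * R) powr \<delta>"
      by (simp add: i expo_def powr_add pow)
    also have "C * (4 ^ l * (4 ^ p * 4 ^ k) * (\<bar>x1\<bar> ^ l * \<bar>x2\<bar> ^ p * \<bar>x3\<bar> ^ k)) * \<dots>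
        = D * (?y x1 a1 ^ l * (?y x2 a2 ^ p * ?y x3 a3 ^ k))"
      by (simp add: D_def power_mult_distrib)
    also have "\<dots> \<le> D * ((1/2) ^ l * ((1/2) ^ p * (1/2) ^ k))"
      using half q C(1) by (intro mult_left_mono mult_mono) (auto simp: D_def)
    finally show "\<bar>coeff i\<bar> * rGamma (expo i + \<delta>) * R powr (expo i + \<delta>)
        \<le> D * (case i of (l, p, k) \<Rightarrow> (1/2) ^ l * ((1/2) ^ p * (1/2) ^ k))"
      by (simp add: i)
  qed
qed

lemma abs_summable_kterm:
  assumes "\<delta> > 0" "r \<ge> 0"
  shows "(\<lambda>i. \<bar>kterm \<delta> i r\<bar>) summable_on UNIV"
proof (cases "r = 0")
  case True
  have "(\<lambda>i. \<bar>kterm \<delta> i r\<bar>) = (\<lambda>i. 0)"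
    by (simp add: True kterm_def)
  then show ?thesis by (simp only: summable_on_0)
next
  case False
  then have r: "r > 0" using assms by simp
  have "\<bar>kterm \<delta> i r\<bar> = (\<bar>coeff i\<bar> * rGamma (expo i + \<delta>) * r powr (expo i + \<delta>)) * inverse r" for i
    unfolding abs_kterm[OF assms(1)] powr_diff_one[OF r] by (simp only: divide_inverse mult.assoc)
  then have eq: "(\<lambda>i. \<bar>kterm \<delta> i r\<bar>)
      = (\<lambda>i. (\<bar>coeff i\<bar> * rGamma (expo i + \<delta>) * r powr (expo i + \<delta>)) * inverse r)"
    by (rule ext)
  show ?thesis
    unfolding eq by (intro summable_on_cmult_left summable_majorant assms(1) r)
qed

lemma summable_kterm:
  assumes "\<delta> > 0" "r \<ge> 0"
  shows "(\<lambda>i. kterm \<delta> i r) summable_on UNIV"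
  by (rule abs_summable_summable) (use abs_summable_kterm[OF assms] in simp)

lemma kernel_sums:
  assumes "\<delta> > 0" "r \<ge> 0"
  shows "(\<lambda>n. kterm \<delta> (enum n) r) sums kernel \<delta> r"
  unfolding kernel_def
  by (intro has_sum_imp_sums)
    (simp add: has_sum_reindex_bij_betw[OF bij_enum, where f = "\<lambda>i. kterm \<delta> i r"]
      has_sum_infsum summable_kterm[OF assms])

lemma summable_enum:
  fixes f :: "nat \<times> nat \<times> nat \<Rightarrow> real"
  assumes "f summable_on UNIV"
  shows "summable (\<lambda>n. f (enum n))"
  using assms summable_on_reindex_bij_betw[OF bij_enum, of f]
  by (auto intro: summable_on_imp_summable)

lemma kernel_eq_suminf:
  assumes "\<delta> > 0" "r \<ge> 0"
  shows "kernel \<delta> r = (\<Sum>n. kterm \<delta> (enum n) r)"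
  using kernel_sums[OF assms] by (simp add: sums_iff)

section \<open>Differentiation, fractional integration and continuity\<close>

text \<open>Each term differentiates correctly by \<open>z * rGamma (z + 1) = rGamma z\<close>. The
  Weierstrass test on a compact neighbourhood of \<open>r\<close> away from 0 allows termwise
  differentiation.\<close>

lemma kernel_has_derivative:
  assumes "\<delta> > 0" "r > 0"
  shows "(kernel (\<delta> + 1) has_real_derivative kernel \<delta> r) (at r)"
proof -
  let ?S = "{r / 2..2 * r}"
  let ?M = "\<lambda>i. (\<bar>coeff i\<bar> * rGamma (expo i + \<delta>) * (2 * r) powr (expo i + \<delta>)) * (2 / r)"
  have r: "r \<in> interior ?S" using assms by simp
  have deriv: "(kterm (\<delta> + 1) i has_real_derivative kterm \<delta> i x) (at x within ?S)" if "x \<in> ?S" for i x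
  proof -
    have "x > 0" using that assms by auto
    then have "((\<lambda>x. coeff i * rGamma (expo i + \<delta> + 1) * x powr (expo i + \<delta>)) has_real_derivative
        coeff i * rGamma (expo i + \<delta> + 1) * ((expo i + \<delta>) * x powr (expo i + \<delta> - 1))) (at x within ?S)"
      by (intro DERIV_cmult has_real_derivative_powr[THEN DERIV_subset]) auto
    moreover have "kterm (\<delta> + 1) i = (\<lambda>x. coeff i * rGamma (expo i + \<delta> + 1) * x powr (expo i + \<delta>))"
      by (simp add: kterm_def fun_eq_iff add.assoc)
    moreover have "kterm \<delta> i x =
        coeff i * rGamma (expo i + \<delta> + 1) * ((expo i + \<delta>) * x powr (expo i + \<delta> - 1))"
      unfolding kterm_def rGamma_plus1[of "expo i + \<delta>", symmetric] by simp
    ultimately show ?thesis by simp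
  qed
  have bound: "norm (kterm \<delta> (enum n) x) \<le> ?M (enum n)" if "x \<in> ?S" for n x
  proof -
    let ?s = "expo (enum n) + \<delta>"
    have s: "?s > 0" using expo_nonneg[of "enum n"] assms by simp
    have x: "x > 0" using that assms by auto
    \<comment> \<open>The exponent \<open>?s - 1\<close> may be negative, so \<open>1 / x\<close> is
      split off and bounded by \<open>2 / r\<close>, while \<open>x powr ?s\<close> is
      increasing.\<close>
    have "x powr (?s - 1) = x powr ?s * (1 / x)"
      using x by (simp add: powr_diff_one)
    also have "\<dots> \<le> (2 * r) powr ?s * (2 / r)"
      using that x s assms by (intro mult_mono powr_mono2) (auto simp: field_simps)
    finally have "\<bar>coeff (enum n)\<bar> * rGamma ?s * x powr (?s - 1)
        \<le> \<bar>coeff (enum n)\<bar> * rGamma ?s * ((2 * r) powr ?s * (2 / r))"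
      using rGamma_nonneg_real[OF s] by (intro mult_left_mono) auto
    then show ?thesis
      by (simp only: real_norm_def abs_kterm[OF assms(1)] mult.assoc)
  qed
  have summ: "summable (\<lambda>n. ?M (enum n))"
    by (rule summable_enum[where f = ?M]) (use assms in \<open>intro summable_on_cmult_left summable_majorant; simp\<close>)
  have "((\<lambda>x. \<Sum>n. kterm (\<delta> + 1) (enum n) x) has_real_derivative (\<Sum>n. kterm \<delta> (enum n) r)) (at r)"
  proof (rule has_field_derivative_series'(2)[of ?S])
    show "uniformly_convergent_on ?S (\<lambda>n x. \<Sum>i<n. kterm \<delta> (enum i) x)"
      using bound summ by (rule Weierstrass_m_test')
    show "summable (\<lambda>n. kterm (\<delta> + 1) (enum n) r)"
      using kernel_sums[of "\<delta> + 1" r] assms by (simp add: sums_iff)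
  qed (use deriv r assms in auto)
  then have "((\<lambda>x. \<Sum>n. kterm (\<delta> + 1) (enum n) x) has_real_derivative kernel \<delta> r) (at r)"
    using assms by (simp add: kernel_eq_suminf)
  then show ?thesis
    by (rule has_field_derivative_transform_within_open[of _ _ _ "{0<..}"])
      (use assms in \<open>auto simp: kernel_eq_suminf\<close>)
qed

text \<open>Up to the factor \<open>Gamma \<sigma>\<close> this is the Riemann-Liouville integral of
  order \<sigma>. Termwise, the Beta function replaces \<open>rGamma s\<close> by
  \<open>Gamma \<sigma> * rGamma (s + \<sigma>)\<close>.\<close>

lemma kernel_fractional_integral:
  assumes "\<delta> > 0" "\<sigma> > 0" "r > 0"
  shows "has_bochner_integral lborel
    (\<lambda>s. indicator {0<..<r} s * ((r - s) powr (\<sigma> - 1) * kernel \<delta> s)) (Gamma \<sigma> * kernel (\<delta> + \<sigma>) r)"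
proof -
  let ?f = "\<lambda>n s. indicator {0<..<r} s * ((r - s) powr (\<sigma> - 1) * kterm \<delta> (enum n) s)"
  let ?c = "\<lambda>i. coeff i * rGamma (expo i + \<delta>)"
  \<comment> \<open>The constant \<open>c\<close> is left free: \<open>coeff i\<close> gives the
    terms, and its absolute value gives their norms, the other factors being nonnegative.\<close>
  have conv: "has_bochner_integral lborel
      (\<lambda>s. c * rGamma (expo i + \<delta>) *
        (indicator {0<..<r} s * ((r - s) powr (\<sigma> - 1) * s powr (expo i + \<delta> - 1))))
      (Gamma \<sigma> * (c * rGamma (expo i + (\<delta> + \<sigma>)) * r powr (expo i + (\<delta> + \<sigma>) - 1)))"
    (is "has_bochner_integral _ ?h ?I") for c i
  proof -
    have s: "expo i + \<delta> > 0" using expo_nonneg[of i] assms by simp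
    have index: "\<sigma> + (expo i + \<delta>) = expo i + (\<delta> + \<sigma>)" by simp
    have "has_bochner_integral lborel ?h (c * rGamma (expo i + \<delta>) *
        (Beta \<sigma> (expo i + \<delta>) * r powr (\<sigma> + (expo i + \<delta>) - 1)))"
      by (intro has_bochner_integral_mult_right has_bochner_integral_powr_convolution assms s)
    also have "c * rGamma (expo i + \<delta>) * (Beta \<sigma> (expo i + \<delta>) * r powr (\<sigma> + (expo i + \<delta>) - 1)) = ?I"
      using Gamma_real_pos[OF s] unfolding Beta_altdef index
      by (simp add: rGamma_inverse_Gamma[of "expo i + \<delta>"])
    finally show ?thesis .
  qed
  have f: "has_bochner_integral lborel (?f n) (Gamma \<sigma> * kterm (\<delta> + \<sigma>) (enum n) r)" for n
  proof -
    have "?f n = (\<lambda>s. coeff (enum n) * rGamma (expo (enum n) + \<delta>) *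
        (indicator {0<..<r} s * ((r - s) powr (\<sigma> - 1) * s powr (expo (enum n) + \<delta> - 1))))"
      by (simp add: fun_eq_iff kterm_def)
    then show ?thesis
      using conv[of "coeff (enum n)" "enum n"] by (simp only: kterm_def)
  qed
  have norm_f: "has_bochner_integral lborel (\<lambda>s. norm (?f n s)) (Gamma \<sigma> * \<bar>kterm (\<delta> + \<sigma>) (enum n) r\<bar>)" for n
  proof -
    have "(\<lambda>s. norm (?f n s)) = (\<lambda>s. \<bar>coeff (enum n)\<bar> * rGamma (expo (enum n) + \<delta>) *
        (indicator {0<..<r} s * ((r - s) powr (\<sigma> - 1) * s powr (expo (enum n) + \<delta> - 1))))"
      by (simp add: fun_eq_iff abs_mult abs_kterm[OF assms(1)])
    moreover have "\<delta> + \<sigma> > 0" using assms by simp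
    ultimately show ?thesis
      using conv[of "\<bar>coeff (enum n)\<bar>" "enum n"] by (simp only: abs_kterm)
  qed
  have pointwise: "(\<lambda>n. ?f n s) sums (indicator {0<..<r} s * ((r - s) powr (\<sigma> - 1) * kernel \<delta> s))" for s
    using kernel_sums[OF assms(1), of s] by (cases "s \<in> {0<..<r}") (auto intro!: sums_mult)
  have AE: "AE s in lborel. summable (\<lambda>n. norm (?f n s))"
  proof (rule AE_I2)
    fix s
    have "summable (\<lambda>n. (r - s) powr (\<sigma> - 1) * \<bar>kterm \<delta> (enum n) s\<bar>)" if "s > 0"
      using that assms
      by (intro summable_mult summable_enum[where f = "\<lambda>i. \<bar>kterm \<delta> i s\<bar>"] abs_summable_kterm) auto
    then show "summable (\<lambda>n. norm (?f n s))"
      by (cases "s \<in> {0<..<r}") (auto simp: abs_mult)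
  qed
  \<comment> \<open>The norms integrate to absolute terms of the series with raised index, so
    absolute convergence there permits exchanging sum and integral.\<close>
  have summ: "summable (\<lambda>n. \<integral>s. norm (?f n s) \<partial>lborel)"
    unfolding has_bochner_integral_integral_eq[OF norm_f] using assms
    by (intro summable_mult summable_enum[where f = "\<lambda>i. \<bar>kterm (\<delta> + \<sigma>) i r\<bar>"] abs_summable_kterm) auto
  have int: "integrable lborel (?f n)" for n
    using f by (rule integrable.intros)
  have "(\<lambda>s. \<Sum>n. ?f n s) = (\<lambda>s. indicator {0<..<r} s * ((r - s) powr (\<sigma> - 1) * kernel \<delta> s))"
    using pointwise by (auto simp: sums_iff)
  moreover have "(\<lambda>n. integral\<^sup>L lborel (?f n)) sums (Gamma \<sigma> * kernel (\<delta> + \<sigma>) r)"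
    unfolding has_bochner_integral_integral_eq[OF f]
    using kernel_sums[of "\<delta> + \<sigma>" r] assms by (intro sums_mult) simp
  ultimately show ?thesis
    using integrable_suminf[OF int AE summ] sums_integral[OF int AE summ]
    by (simp add: has_bochner_integral_iff sums_iff)
qed

text \<open>Away from 0 this is differentiability. On the unit interval
  \<open>x powr \<delta>\<close> factors out of all terms, leaving a convergent constant, so the
  limit at 0 is the value 0.\<close>

lemma continuous_on_kernel:
  assumes "\<delta> > 0"
  shows "continuous_on {0..} (kernel (\<delta> + 1))"
proof -
  have "continuous (at r within {0..}) (kernel (\<delta> + 1))" if "r \<ge> 0" for r
  proof (cases "r = 0")
    case False
    then show ?thesis
      using kernel_has_derivative[OF assms, of r] that
      by (auto dest!: DERIV_isCont intro: continuous_at_imp_continuous_at_within)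
  next
    case True
    let ?M = "\<lambda>i. \<bar>coeff i\<bar> * rGamma (expo i + (\<delta> + 1)) * 1 powr (expo i + (\<delta> + 1))"
    have "\<bar>kernel (\<delta> + 1) x\<bar> \<le> x powr \<delta> * (\<Sum>\<^sub>\<infinity>i. ?M i)" if "0 \<le> x" "x \<le> 1" for x
    proof -
      have summ: "(\<lambda>i. x powr \<delta> * ?M i) summable_on UNIV"
        using assms by (intro summable_on_cmult_right summable_majorant) auto
      have abs: "(\<lambda>i. \<bar>kterm (\<delta> + 1) i x\<bar>) summable_on UNIV"
        using that assms by (intro abs_summable_kterm) auto
      have "\<bar>kernel (\<delta> + 1) x\<bar> \<le> (\<Sum>\<^sub>\<infinity>i. \<bar>kterm (\<delta> + 1) i x\<bar>)"
        using norm_infsum_bound[of "\<lambda>i. kterm (\<delta> + 1) i x" UNIV] abs by (simp add: kernel_def)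
      also have "\<dots> \<le> (\<Sum>\<^sub>\<infinity>i. x powr \<delta> * ?M i)"
      proof (rule infsum_mono[OF abs summ])
        fix i
        have "rGamma (expo i + (\<delta> + 1)) \<ge> 0"
          using expo_nonneg[of i] assms by (intro rGamma_nonneg_real) simp
        moreover have "x powr (expo i + \<delta>) \<le> x powr \<delta>"
          using that expo_nonneg[of i] by (intro powr_mono') auto
        ultimately show "\<bar>kterm (\<delta> + 1) i x\<bar> \<le> x powr \<delta> * ?M i"
          using assms mult_left_mono[of "x powr (expo i + \<delta>)" "x powr \<delta>"
              "\<bar>coeff i\<bar> * rGamma (expo i + (\<delta> + 1))"]
          by (simp add: abs_kterm mult_ac add_ac)
      qed
      also have "\<dots> = x powr \<delta> * (\<Sum>\<^sub>\<infinity>i. ?M i)"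
        by (rule infsum_cmult_right')
      finally show ?thesis .
    qed
    then have "\<forall>\<^sub>F x in at 0 within {0..}. norm (kernel (\<delta> + 1) x) \<le> x powr \<delta> * (\<Sum>\<^sub>\<infinity>i. ?M i)"
      unfolding eventually_at by (intro exI[of _ 1]) (auto simp: dist_real_def)
    moreover have "((\<lambda>x. x powr \<delta> * (\<Sum>\<^sub>\<infinity>i. ?M i)) \<longlongrightarrow> 0) (at 0 within {0..})"
      using assms
      by (intro tendsto_mult_left_zero tendsto_zero_powrI[where b = \<delta>] tendsto_ident_at tendsto_const)
        (auto simp: eventually_at_filter)
    ultimately have "(kernel (\<delta> + 1) \<longlongrightarrow> 0) (at 0 within {0..})"
      by (rule Lim_null_comparison)
    moreover have "kernel (\<delta> + 1) 0 = 0" by (simp add: kernel_def kterm_def)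
    ultimately show ?thesis using True by (simp add: continuous_within)
  qed
  then show ?thesis by (simp add: continuous_on_eq_continuous_within)
qed

section \<open>The Pascal recurrence summed over all indices\<close>

text \<open>The recurrence splits \<open>coeff\<close> into a unit mass at the origin and three
  copies of itself, each shifted along one axis. A shift along axis \<open>i\<close> raises the
  exponent by \<open>ai\<close> and so becomes a raised index of the kernel.\<close>

lemma kernel_one:
  assumes "r > 0"
  shows "kernel 1 r = 1 + x1 * kernel (1 + a1) r + x2 * kernel (1 + a2) r + x3 * kernel (1 + a3) r"
proof -
  define g where "g i = rGamma (expo i + 1) * r powr expo i" for i
  \<comment> \<open>All three shifts are handled by reindexing along an injection \<open>S\<close>
    outside whose range \<open>u\<close> vanishes.\<close>
  have step: "(\<Sum>\<^sub>\<infinity>i. u i * g i) = x * kernel (1 + a) r" "(\<lambda>i. u i * g i) summable_on UNIV"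
    if "a > 0" "inj S" "\<And>j. expo (S j) = expo j + a" "\<And>j. u (S j) = x * coeff j" "\<And>i. i \<notin> range S \<Longrightarrow> u i = 0"
    for u :: "nat \<times> nat \<times> nat \<Rightarrow> real" and S x a
  proof -
    have eq: "(\<lambda>i. u i * g i) \<circ> S = (\<lambda>j. x * kterm (1 + a) j r)"
      by (auto simp: that g_def kterm_def mult_ac add_ac)
    have "(\<lambda>i. x * kterm (1 + a) i r) summable_on UNIV"
      using that assms by (intro summable_on_cmult_right summable_kterm) auto
    then have "(\<lambda>i. u i * g i) summable_on range S"
      by (simp add: summable_on_reindex[OF that(2)] eq)
    then show "(\<lambda>i. u i * g i) summable_on UNIV"
      by (rule summable_on_cong_neutral[THEN iffD1, rotated -1]) (auto simp: that)
    have "(\<Sum>\<^sub>\<infinity>i. u i * g i) = infsum (\<lambda>i. u i * g i) (range S)"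
      by (rule infsum_cong_neutral) (auto simp: that)
    also have "\<dots> = x * kernel (1 + a) r"
      by (simp add: infsum_reindex[OF that(2)] eq kernel_def infsum_cmult_right')
    finally show "(\<Sum>\<^sub>\<infinity>i. u i * g i) = x * kernel (1 + a) r" .
  qed
  define u1 where "u1 = (\<lambda>(l, p, k). if l = 0 then 0 else x1 * coeff (l - 1, p, k))"
  define u2 where "u2 = (\<lambda>(l, p, k). if p = 0 then 0 else x2 * coeff (l, p - 1, k))"
  define u3 where "u3 = (\<lambda>(l, p, k). if k = 0 then 0 else x3 * coeff (l, p, k - 1))"
  define u0 :: "nat \<times> nat \<times> nat \<Rightarrow> real" where "u0 = (\<lambda>i. if i = (0, 0, 0) then 1 else 0)"
  note s1 = step[of a1 "\<lambda>(l, p, k). (Suc l, p, k)" u1 x1]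
  note s2 = step[of a2 "\<lambda>(l, p, k). (l, Suc p, k)" u2 x2]
  note s3 = step[of a3 "\<lambda>(l, p, k). (l, p, Suc k)" u3 x3]
  have u1: "(\<Sum>\<^sub>\<infinity>i. u1 i * g i) = x1 * kernel (1 + a1) r" "(\<lambda>i. u1 i * g i) summable_on UNIV"
    by (rule s1; force simp: a1_pos u1_def expo_def inj_def algebra_simps gr0_conv_Suc image_iff)+
  have u2: "(\<Sum>\<^sub>\<infinity>i. u2 i * g i) = x2 * kernel (1 + a2) r" "(\<lambda>i. u2 i * g i) summable_on UNIV"
    by (rule s2; force simp: a2_pos u2_def expo_def inj_def algebra_simps gr0_conv_Suc image_iff)+
  have u3: "(\<Sum>\<^sub>\<infinity>i. u3 i * g i) = x3 * kernel (1 + a3) r" "(\<lambda>i. u3 i * g i) summable_on UNIV"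
    by (rule s3; force simp: a3_pos u3_def expo_def inj_def algebra_simps gr0_conv_Suc image_iff)+
  \<comment> \<open>The origin contributes \<open>rGamma 1 * r powr 0\<close>, which is 1 because
    \<open>r > 0\<close>.\<close>
  have u0: "((\<lambda>i. u0 i * g i) has_sum 1) UNIV"
  proof -
    have "((\<lambda>i. u0 i * g i) has_sum (\<Sum>i\<in>{(0,0,0)}. u0 i * g i)) {(0,0,0)}"
      by (rule has_sum_finite) simp
    then have "((\<lambda>i. u0 i * g i) has_sum 1) {(0,0,0)}"
      using assms by (simp add: u0_def g_def expo_def rGamma_inverse_Gamma)
    then show ?thesis
      by (rule has_sum_cong_neutral[THEN iffD1, rotated -1]) (auto simp: u0_def)
  qed
  have coeff: "coeff i = u0 i + u1 i + u2 i + u3 i" for i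
  proof -
    obtain l p k where i: "i = (l, p, k)" by (cases i) auto
    show ?thesis
    proof (cases "l + p + k = 0")
      case True
      then show ?thesis by (simp add: i u0_def u1_def u2_def u3_def coeff_def trinom_def)
    next
      case False
      let ?P = "x1 ^ l * x2 ^ p * x3 ^ k"
      have "u1 i = (if l = 0 then 0 else trinom (l - 1) p k) * ?P"
        by (cases l) (simp_all add: i u1_def coeff_def)
      moreover have "u2 i = (if p = 0 then 0 else trinom l (p - 1) k) * ?P"
        by (cases p) (simp_all add: i u2_def coeff_def)
      moreover have "u3 i = (if k = 0 then 0 else trinom l p (k - 1)) * ?P"
        by (cases k) (simp_all add: i u3_def coeff_def)
      moreover have "u0 i = 0" using False by (auto simp: i u0_def)
      moreover have "coeff i = trinom l p k * ?P" by (simp add: i coeff_def)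
      moreover note trinom_recurrence[of l p k]
      ultimately show ?thesis using False by (simp only: distrib_right)
    qed
  qed
  have "kernel 1 r = (\<Sum>\<^sub>\<infinity>i. u0 i * g i + u1 i * g i + u2 i * g i + u3 i * g i)"
    by (simp add: kernel_def kterm_def coeff g_def algebra_simps)
  also have "\<dots> = 1 + x1 * kernel (1 + a1) r + x2 * kernel (1 + a2) r + x3 * kernel (1 + a3) r"
    using u0 u1 u2 u3 by (simp add: infsum_add summable_on_add has_sum_imp_summable infsumI)
  finally show ?thesis .
qed

section \<open>Identification with the Mittag-Leffler function\<close>

text \<open>The powers of \<open>r\<close> in the arguments combine to \<open>r powr expo i\<close>,
  and the prefactor supplies the rest of the exponent. At \<open>r = 0\<close> both sides
  vanish.\<close>

lemma mittag_leffler3_eq_kernel: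
  assumes "\<delta> > 0" "r \<ge> 0"
  shows "r powr \<delta> * mittag_leffler3 a1 a2 a3 (\<delta> + 1) (x1 * r powr a1) (x2 * r powr a2) (x3 * r powr a3)
    = kernel (\<delta> + 1) r"
proof (cases "r = 0")
  case True
  then show ?thesis using assms by (simp add: kernel_def kterm_def)
next
  case False
  then have r: "r > 0" using assms by simp
  let ?f = "\<lambda>l p k. trinom l p k * ((x1 * r powr a1) ^ l * (x2 * r powr a2) ^ p * (x3 * r powr a3) ^ k)
        * rGamma (real l * a1 + real p * a2 + real k * a3 + (\<delta> + 1))"
  have pow: "(r powr a) ^ n = r powr (real n * a)" for n a
    using r by (simp add: powr_powr[symmetric] powr_realpow[symmetric] mult.commute)
  have f: "kterm (\<delta> + 1) i r = r powr \<delta> * (case i of (l, p, k) \<Rightarrow> ?f l p k)" for i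
    by (cases i) (simp add: kterm_def coeff_def expo_def pow power_mult_distrib powr_add)
  have "(\<lambda>i. r powr \<delta> * (case i of (l, p, k) \<Rightarrow> ?f l p k)) summable_on UNIV"
    using summable_kterm[of "\<delta> + 1" r] assms by (simp add: f)
  then have "(\<lambda>(l, p, k). ?f l p k) summable_on UNIV"
    using r by (simp add: summable_on_cmult_right')
  from infsum_triple_eq_suminf[OF this] show ?thesis
    by (simp add: mittag_leffler3_def kernel_def f infsum_cmult_right' trinom_def)
qed

end

section \<open>The initial value problem\<close>

theorem theorem4p1:
  fixes \<alpha> \<beta> \<gamma> lam1 lam2 lam3 y0 :: real
  assumes "1 \<ge> \<alpha>" and "\<alpha> > \<beta>" and "\<beta> > \<gamma>" and "\<gamma> > 0"
  shows "is_ivp_solution \<alpha> \<beta> \<gamma> lam1 lam2 lam3 y0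
    (\<lambda>r. (1 + lam1 * r powr \<alpha> *
            mittag_leffler3 \<alpha> (\<alpha> - \<gamma>) (\<alpha> - \<beta>) (\<alpha> + 1)
              (lam1 * r powr \<alpha>) (lam2 * r powr (\<alpha> - \<gamma>)) (lam3 * r powr (\<alpha> - \<beta>))) * y0)"
    (is "is_ivp_solution _ _ _ _ _ _ _ ?y")
proof -
  interpret mittag_leffler3_series \<alpha> "\<alpha> - \<gamma>" "\<alpha> - \<beta>" lam1 lam2 lam3
    by unfold_locales (use assms in auto)
  have \<alpha>: "\<alpha> > 0" using assms by simp
  have y: "?y r = (1 + lam1 * kernel (\<alpha> + 1) r) * y0" if "r \<ge> 0" for r
    using mittag_leffler3_eq_kernel[OF \<alpha> that] by (simp add: mult.assoc)
  have deriv: "(?y has_real_derivative lam1 * kernel \<alpha> r * y0) (at r)" if "r > 0" for r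
  proof (rule has_field_derivative_transform_within_open[of _ _ _ "{0<..}"])
    show "((\<lambda>r. (1 + lam1 * kernel (\<alpha> + 1) r) * y0) has_real_derivative lam1 * kernel \<alpha> r * y0) (at r)"
      using kernel_has_derivative[OF \<alpha> that] by (auto intro!: derivative_eq_intros)
  qed (use that in \<open>auto simp: y\<close>)
  have diff: "?y differentiable (at r)" if "r > 0" for r
    using deriv[OF that] unfolding real_differentiable_def by (rule exI)
  \<comment> \<open>One formula serves all three orders: the constant 1 in the solution has
    derivative 0, and fractional integration of order \<open>1 - \<rho>\<close> turns index \<alpha>
    into \<open>\<alpha> + 1 - \<rho>\<close>.\<close>
  have caputo: "caputo_differentiable \<rho> ?y r \<and> caputo_deriv \<rho> ?y r = lam1 * kernel (\<alpha> + 1 - \<rho>) r * y0"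
    if "r > 0" "\<rho> \<le> \<alpha>" for r \<rho>
  proof (cases "\<rho> = 1")
    case True
    \<comment> \<open>Order 1 occurs only for \<alpha> = 1, where the index
      \<open>\<alpha> + 1 - \<rho>\<close> is \<alpha> itself.\<close>
    then have "\<alpha> = 1" using that assms by simp
    then show ?thesis
      using True diff[OF that(1)] DERIV_imp_deriv[OF deriv[OF that(1)]]
      by (simp add: caputo_differentiable_def caputo_deriv_def)
  next
    case False
    then have \<rho>: "1 - \<rho> > 0" using that assms by simp
    have integrand: "indicator {0<..<r} s *\<^sub>R ((r - s) powr (- \<rho>) * deriv ?y s)
        = (lam1 * y0) * (indicator {0<..<r} s * ((r - s) powr (1 - \<rho> - 1) * kernel \<alpha> s))" for s
    proof (cases "s \<in> {0<..<r}")
      case True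
      then have "deriv ?y s = lam1 * kernel \<alpha> s * y0"
        by (intro DERIV_imp_deriv deriv) simp
      then show ?thesis by (simp add: mult_ac)
    qed simp
    have I: "has_bochner_integral lborel
        (\<lambda>s. indicator {0<..<r} s *\<^sub>R ((r - s) powr (- \<rho>) * deriv ?y s))
        ((lam1 * y0) * (Gamma (1 - \<rho>) * kernel (\<alpha> + (1 - \<rho>)) r))"
      unfolding integrand
      by (intro has_bochner_integral_mult_right kernel_fractional_integral \<alpha> \<rho> that(1))
    have "Gamma (1 - \<rho>) > 0" using \<rho> by simp
    then have "caputo_deriv \<rho> ?y r = lam1 * kernel (\<alpha> + 1 - \<rho>) r * y0"
      using has_bochner_integral_integral_eq[OF I] False
      by (simp add: caputo_deriv_def set_lebesgue_integral_def add_diff_eq)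
    moreover have "caputo_differentiable \<rho> ?y r"
      using integrable.intros[OF I] False diff
      by (simp add: caputo_differentiable_def set_integrable_def)
    ultimately show ?thesis by simp
  qed
  have eqn: "caputo_deriv \<alpha> ?y r - lam3 * caputo_deriv \<beta> ?y r - lam2 * caputo_deriv \<gamma> ?y r - lam1 * ?y r = 0"
    if "r > 0" for r
  proof -
    \<comment> \<open>For the orders \<alpha>, \<beta>, \<gamma> the resulting indices are 1,
      \<open>1 + a3\<close> and \<open>1 + a2\<close>, exactly those in
      \<open>kernel_one\<close>.\<close>
    have "caputo_deriv \<alpha> ?y r = lam1 * kernel 1 r * y0"
      "caputo_deriv \<beta> ?y r = lam1 * kernel (1 + (\<alpha> - \<beta>)) r * y0"
      "caputo_deriv \<gamma> ?y r = lam1 * kernel (1 + (\<alpha> - \<gamma>)) r * y0"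
      using caputo[OF that, of \<alpha>] caputo[OF that, of \<beta>] caputo[OF that, of \<gamma>] assms
      by (simp_all add: add_ac add_diff_eq)
    moreover have "?y r = (1 + lam1 * kernel (1 + \<alpha>) r) * y0"
      using y[of r] that by (simp add: add_ac)
    \<comment> \<open>What remains is \<open>lam1 * y0\<close> times the identity
      \<open>kernel_one\<close>.\<close>
    ultimately show ?thesis
      unfolding kernel_one[OF that] by (simp only:) (simp add: algebra_simps)
  qed
  have "continuous_on {0..} ?y"
    by (subst continuous_on_cong[OF refl y]) (auto intro!: continuous_intros continuous_on_kernel \<alpha>)
  moreover have "?y 0 = y0" using \<alpha> by simp
  ultimately show ?thesis
    using caputo eqn assms by (simp add: is_ivp_solution_def)
qed

end
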